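(* Let $G=(V,E,\sigma,T)$ be a temporal graph, let $s,t\in V$ be distinct vertices, and let $\Gamma=\Gamma^{\mathrm{trp}}(s,t)$ be the family of time-respecting paths from $s$ to $t$, assumed nonempty, with temporal usage matrix $\mathcal{N}$ (given by $\mathcal{N}(\gamma,e)=\varphi(\tau)$ if $(e,\tau)\in\gamma$ and $\mathcal{N}(\gamma,e)=0$ if $e$ does not occur in $\gamma$). Then the following hold. (a) Let $p\in(1,\infty)$, $q=p/(p-1)$, and $\hat\sigma(e)=\sigma(e)^{-q/p}$ for $e\in E$. Then $$\mathrm{Mod}_{p,\sigma}(\Gamma)=\left(\min_{\substack{\mu\in\mathcal{P}(\Gamma)\\ \eta=\mathcal{N}^T\mu}}\ \sum_{e\in E}\hat\sigma(e)\eta(e)^q\right)^{-p/q}=\left(\min_{\substack{\mu\in\mathcal{P}(\Gamma)\\ \eta=\mathcal{N}^T\mu}}\mathcal{E}_{q,\hat\sigma}(\eta)\right)^{-p/q}.$$ Moreover, although an optimal $\mu^*$ on the right-hand side need not be unique, there is a unique optimal $\eta^*$ (that is, $\eta^*=\mathcal{N}^T\mu^*$ is the same for every optimal $\mu^*$), and it is related to the unique optimal density $\rho^*$ for $\mathrm{Mod}_{p,\sigma}(\Gamma)$ by $$\frac{\sigma(e)\rho^*(e)^p}{\mathcal{E}_{p,\sigma}(\rho^* )}=\frac{\hat\sigma(e)\eta^*(e)^q}{\mathcal{E}_{q,\hat\sigma}(\eta^* )}\qquad\text{for all } e\in E.$$ (b) With $\sigma^{-1}(e)=1/\sigma(e)$,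 $$\mathrm{Mod}_{1,\sigma}(\Gamma)^{-1}=\min_{\substack{\mu\in\mathcal{P}(\Gamma)\\ \eta=\mathcal{N}^T\mu}}\mathcal{E}_{\infty,\sigma^{-1}}(\eta)\qquad\text{and}\qquad \mathrm{Mod}_{\infty,\sigma}(\Gamma)^{-1}=\min_{\substack{\mu\in\mathcal{P}(\Gamma)\\ \eta=\mathcal{N}^T\mu}}\mathcal{E}_{1,\sigma^{-1}}(\eta).$$
   Context: A temporal graph $G=(V,E,\sigma,T)$ consists of a finite graph with vertex set $V$ and edge set $E$ (directed or undirected, parallel edges allowed), edge weights $\sigma:E\to(0,\infty)$, and a map $T$ assigning to each edge $e$ a finite nonempty set $T(e)\subset(0,\infty)$ of times at which $e$ is available. A time-respecting path from $s$ to $t$ is a set of edge-time pairs $\gamma=\{(e_1,t_1),\dots,(e_k,t_k)\}$, with the edges $e_i$ pairwise distinct, such that $e_1e_2\cdots e_k$, traversed in order, is a path from $s$ to $t$, $t_i\in T(e_i)$ for all $i$, and $t_1<t_2<\cdots<t_k$. $\Gamma^{\mathrm{trp}}(s,t)$ is the (finite) set of all such paths. The temporal penalty function $\varphi:\mathbb{R}\to[0,\infty)$ is a fixed continuous, strictly increasing function with $\varphi(0)=1$. A density is a vector $\rho\in\mathbb{R}^E_{\ge0}$. Its $\rho$-length on $\gamma\in\Gamma$ is $\ell_\rho(\gamma)=\sum_{e\in E}\mathcal{N}(\gamma,e)\rho(e)$. The set of admissible densities is $\mathrm{Adm}(\Gamma)=\{\rho\in\mathbb{R}^E_{\ge0}:\ell_\rho(\gamma)\ge1\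 \forall\gamma\in\Gamma\}$. For positive weights $w$ on $E$ and $\rho\in\mathbb{R}^E_{\ge 0}$, the energy is $\mathcal{E}_{p,w}(\rho)=\sum_{e\in E}w(e)\rho(e)^p$ for $1\le p<\infty$ and $\mathcal{E}_{\infty,w}(\rho)=\max_{e\in E}w(e)\rho(e)$. The $p$-modulus is $\mathrm{Mod}_{p,\sigma}(\Gamma)=\min_{\rho\in\mathrm{Adm}(\Gamma)}\mathcal{E}_{p,\sigma}(\rho)$; a minimizer is called an optimal density, and it is unique for $p\in(1,\infty)$. $\mathcal{P}(\Gamma)=\{\mu\in\mathbb{R}^\Gamma_{\ge0}:\sum_{\gamma\in\Gamma}\mu(\gamma)=1\}$ is the set of probability mass functions on $\Gamma$, and $(\mathcal{N}^T\mu)(e)=\sum_{\gamma\in\Gamma}\mathcal{N}(\gamma,e)\mu(\gamma)$. *)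

theory Defs
  imports "HOL-Analysis.Analysis" "Graph_Theory.Digraph"
begin

text \<open>
  The underlying finite multigraph is a \<open>fin_digraph\<close>. It is used for both directed and
  undirected graphs: in the undirected case \<open>tail\<close> and \<open>head\<close> merely list the two ends of an
  edge, in arbitrary order, and the flag \<open>directed\<close> below decides whether an edge may only be
  traversed from tail to head or in both ways.
\<close>

locale temporal_graph = fin_digraph G for G :: "('v, 'e) pre_digraph" +
  fixes \<sigma> :: "'e \<Rightarrow> real" and T :: "'e \<Rightarrow> real set"
  assumes weight_pos: "e \<in> arcs G \<Longrightarrow> 0 < \<sigma> e"
    and finite_times: "e \<in> arcs G \<Longrightarrow> finite (T e)"
    and times_nonempty: "e \<in> arcs G \<Longrightarrow> T e \<noteq> {}"
    and times_pos: "e \<in> arcs G \<Longrightarrow> T e \<subseteq> {0<..}"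

definition traverses ::
  "('v, 'e) pre_digraph \<Rightarrow> bool \<Rightarrow> 'v \<Rightarrow> 'e \<Rightarrow> 'v \<Rightarrow> bool" where
  "traverses G directed u e v \<longleftrightarrow>
     tail G e = u \<and> head G e = v \<or> \<not> directed \<and> head G e = u \<and> tail G e = v"

text \<open>
  The word ``path'' is used in the literature on temporal graphs both for walks without repeated
  vertices (\<open>vertex_simple = True\<close>) and for walks that may revisit a vertex, as long as no edge
  is repeated (\<open>vertex_simple = False\<close>).
\<close>

definition time_respecting_paths ::
  "('v, 'e) pre_digraph \<Rightarrow> bool \<Rightarrow> bool \<Rightarrow> ('e \<Rightarrow> real set) \<Rightarrow> 'v \<Rightarrow> 'v \<Rightarrow> ('e \<times> real) set set" where
  "time_respecting_paths G directed vertex_simple T s t =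
     {\<gamma>. \<exists>es ts vs.
        \<gamma> = set (zip es ts) \<and> length ts = length es \<and> length vs = length es + 1 \<and>
        set es \<subseteq> arcs G \<and> set vs \<subseteq> verts G \<and> distinct es \<and> (vertex_simple \<longrightarrow> distinct vs) \<and>
        hd vs = s \<and> last vs = t \<and>
        (\<forall>i < length es. traverses G directed (vs ! i) (es ! i) (vs ! (i + 1))) \<and>
        (\<forall>i < length es. ts ! i \<in> T (es ! i)) \<and>
        sorted_wrt (<) ts}"

definition temporal_penalty :: "(real \<Rightarrow> real) \<Rightarrow> bool" where
  "temporal_penalty \<phi> \<longleftrightarrow>
     continuous_on UNIV \<phi> \<and> strict_mono \<phi> \<and> (\<forall>x. 0 \<le> \<phi> x) \<and> \<phi> 0 = 1"

text \<open>An edge occurs at most once in a time-respecting path, so \<open>\<tau>\<close> is unique.\<close>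

definition temporal_usage :: "(real \<Rightarrow> real) \<Rightarrow> ('e \<times> real) set \<Rightarrow> 'e \<Rightarrow> real" where
  "temporal_usage \<phi> \<gamma> e =
     (if \<exists>\<tau>. (e, \<tau>) \<in> \<gamma> then \<phi> (THE \<tau>. (e, \<tau>) \<in> \<gamma>) else 0)"

text \<open>
  Vectors indexed by a finite set \<open>E\<close> (or \<open>\<Gamma>\<close>) are extensional functions on it, so that equality
  of functions is equality of vectors and uniqueness can be stated with \<open>\<exists>!\<close>.
\<close>

definition rho_length :: "'e set \<Rightarrow> ('g \<Rightarrow> 'e \<Rightarrow> real) \<Rightarrow> ('e \<Rightarrow> real) \<Rightarrow> 'g \<Rightarrow> real" where
  "rho_length E N \<rho> \<gamma> = (\<Sum>e\<in>E. N \<gamma> e * \<rho> e)"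

definition Adm :: "'e set \<Rightarrow> ('g \<Rightarrow> 'e \<Rightarrow> real) \<Rightarrow> 'g set \<Rightarrow> ('e \<Rightarrow> real) set" where
  "Adm E N \<Gamma> = {\<rho> \<in> E \<rightarrow>\<^sub>E {0..}. \<forall>\<gamma>\<in>\<Gamma>. 1 \<le> rho_length E N \<rho> \<gamma>}"

definition energy :: "'e set \<Rightarrow> ereal \<Rightarrow> ('e \<Rightarrow> real) \<Rightarrow> ('e \<Rightarrow> real) \<Rightarrow> real" where
  "energy E p w \<rho> =
     (if p = \<infinity> then Max ((\<lambda>e. w e * \<rho> e) ` E)
      else (\<Sum>e\<in>E. w e * \<rho> e powr real_of_ereal p))"

text \<open>
  This is the minimum of \<open>f\<close> over \<open>S\<close> only if it is attained; \<open>is_arg_min\<close> expresses attainment.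
\<close>

definition minimum :: "('a \<Rightarrow> real) \<Rightarrow> 'a set \<Rightarrow> real" where
  "minimum f S = (LEAST y. y \<in> f ` S)"

definition Modulus ::
  "'e set \<Rightarrow> ('g \<Rightarrow> 'e \<Rightarrow> real) \<Rightarrow> ereal \<Rightarrow> ('e \<Rightarrow> real) \<Rightarrow> 'g set \<Rightarrow> real" where
  "Modulus E N p \<sigma> \<Gamma> = minimum (energy E p \<sigma>) (Adm E N \<Gamma>)"

definition optimal_density ::
  "'e set \<Rightarrow> ('g \<Rightarrow> 'e \<Rightarrow> real) \<Rightarrow> ereal \<Rightarrow> ('e \<Rightarrow> real) \<Rightarrow> 'g set \<Rightarrow> ('e \<Rightarrow> real) \<Rightarrow> bool" where
  "optimal_density E N p \<sigma> \<Gamma> \<rho> \<longleftrightarrow> is_arg_min (energy E p \<sigma>) (\<lambda>\<rho>. \<rho> \<in> Adm E N \<Gamma>) \<rho>"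

definition mass_functions :: "'g set \<Rightarrow> ('g \<Rightarrow> real) set" where
  "mass_functions \<Gamma> = {\<mu> \<in> \<Gamma> \<rightarrow>\<^sub>E {0..}. (\<Sum>\<gamma>\<in>\<Gamma>. \<mu> \<gamma>) = 1}"

definition expected_usage ::
  "'e set \<Rightarrow> ('g \<Rightarrow> 'e \<Rightarrow> real) \<Rightarrow> 'g set \<Rightarrow> ('g \<Rightarrow> real) \<Rightarrow> 'e \<Rightarrow> real" where
  "expected_usage E N \<Gamma> \<mu> = (\<lambda>e\<in>E. \<Sum>\<gamma>\<in>\<Gamma>. N \<gamma> e * \<mu> \<gamma>)"

definition optimal_mass ::
  "'e set \<Rightarrow> ('g \<Rightarrow> 'e \<Rightarrow> real) \<Rightarrow> ereal \<Rightarrow> ('e \<Rightarrow> real) \<Rightarrow> 'g set \<Rightarrow> ('g \<Rightarrow> real) \<Rightarrow> bool" where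
  "optimal_mass E N q w \<Gamma> \<mu> \<longleftrightarrow>
     is_arg_min (\<lambda>\<mu>. energy E q w (expected_usage E N \<Gamma> \<mu>)) (\<lambda>\<mu>. \<mu> \<in> mass_functions \<Gamma>) \<mu>"

end

theory Submission
  imports Defs
begin

text \<open>
  Both sides are linked by \<open>1 \<le> (\<Sum>e\<in>E. \<eta> e * \<rho> e)\<close> for admissible \<open>\<rho>\<close> and expected usages \<open>\<eta>\<close>.
  For \<open>1 < p < \<infinity>\<close>, the optimality condition for \<open>\<eta>\<^sup>*\<close> at each vertex of the simplex of mass
  functions says exactly that \<open>\<rho>\<^sup>* = \<sigma>' \<eta>\<^sup>*\<^sup>q\<^sup>-\<^sup>1 / \<E>\<^sub>q(\<eta>\<^sup>*)\<close> is admissible, and the tangent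
  inequality for \<open>x \<mapsto> x\<^sup>p\<close> at \<open>\<rho>\<^sup>*\<close> shows that it is the unique optimal density. Since \<open>\<eta>\<^sup>*\<close> can be
  recovered from \<open>\<rho>\<^sup>*\<close>, it is unique as well. For \<open>p = \<infinity>\<close> the dual problem is linear and is solved
  by a point mass; \<open>p = 1\<close> is a limiting case of finite exponents.
\<close>

section \<open>Minima, powers with conjugate exponents, and compactness\<close>

text \<open>With one member of the pair fixed, any smaller value of the other factor would push the
  product below 1. This turns a weak duality and one tight pair into optimality of both
  members.\<close>

lemma is_arg_min_of_product:
  fixes F :: "'a \<Rightarrow> real" and H :: "'b \<Rightarrow> real"
  assumes "a \<in> A" "b \<in> B" and ge: "\<forall>a\<in>A. \<forall>b\<in>B. 1 \<le> F a * H b"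
    and "F a * H b \<le> 1" and "0 < H b"
  shows "is_arg_min F (\<lambda>a. a \<in> A) a" "is_arg_min H (\<lambda>b. b \<in> B) b" "F a * H b = 1"
proof -
  show eq: "F a * H b = 1"
    using assms by (simp add: antisym)
  then have "0 < F a"
    using \<open>0 < H b\<close> by (metis zero_less_mult_pos2 zero_less_one)
  have "F a \<le> F a'" if "a' \<in> A" for a'
    using ge[rule_format, OF that \<open>b \<in> B\<close>] eq \<open>0 < H b\<close> by (metis mult_le_cancel_right_pos)
  moreover have "H b \<le> H b'" if "b' \<in> B" for b'
    using ge[rule_format, OF \<open>a \<in> A\<close> that] eq \<open>0 < F a\<close> by (metis mult_le_cancel_left_pos)
  ultimately show "is_arg_min F (\<lambda>a. a \<in> A) a" "is_arg_min H (\<lambda>b. b \<in> B) b"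
    using assms by (auto simp: is_arg_min_linorder)
qed

text \<open>The power \<open>\<sigma> powr (- q / p) * \<eta> powr (q - 1) / A\<close> is the
  equality case of Hoelder's inequality. The first identity compares p-energy and q-energy at an
  edge; the second says that the gradient of the p-energy is proportional to \<eta>. Both reduce to
  the relations between conjugate exponents in \<open>exps\<close>.\<close>

lemma conjugate_powr:
  fixes p q A \<sigma> \<eta> :: real
  assumes p: "1 < p" and q: "q = p / (p - 1)" and "0 < \<sigma>" "0 \<le> \<eta>" "0 < A"
  shows "\<sigma> * (\<sigma> powr (- q / p) * \<eta> powr (q - 1) / A) powr p =
      \<sigma> powr (- q / p) * \<eta> powr q * A powr - p"
    and "\<sigma> * (\<sigma> powr (- q / p) * \<eta> powr (q - 1) / A) powr (p - 1) = \<eta> * A powr (1 - p)"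
proof -
  have exps: "(q - 1) * p = q" "(q - 1) * (p - 1) = 1" "- q / p * p = - q / p - 1"
    "- q / p * (p - 1) = - 1"
    using p by (simp_all add: q field_simps)
  have "\<sigma> * (\<sigma> powr (- q / p) * \<eta> powr (q - 1) / A) powr p =
      \<sigma> * \<sigma> powr (- q / p * p) * \<eta> powr ((q - 1) * p) / A powr p"
    using assms by (simp add: powr_mult powr_divide powr_powr)
  then show "\<sigma> * (\<sigma> powr (- q / p) * \<eta> powr (q - 1) / A) powr p =
      \<sigma> powr (- q / p) * \<eta> powr q * A powr - p"
    unfolding exps using assms by (simp add: powr_diff powr_minus divide_inverse)
  have "\<sigma> * (\<sigma> powr (- q / p) * \<eta> powr (q - 1) / A) powr (p - 1) =
      \<sigma> * \<sigma> powr (- q / p * (p - 1)) * \<eta> powr ((q - 1) * (p - 1)) / A powr (p - 1)"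
    using assms by (simp add: powr_mult powr_divide powr_powr)
  moreover have "A powr (1 - p) = inverse (A powr (p - 1))"
    using powr_minus[of A "p - 1"] by simp
  ultimately show "\<sigma> * (\<sigma> powr (- q / p) * \<eta> powr (q - 1) / A) powr (p - 1) = \<eta> * A powr (1 - p)"
    unfolding exps using assms by (simp add: powr_minus divide_inverse)
qed

text \<open>Strict convexity: the derivative is strictly increasing, so the mean value theorem
  between \<open>x\<close> and \<open>y\<close> gives the strict inequality. The boundary point 0 is
  treated by hand because the derivative of \<open>powr\<close> is taken only at positive
  points.\<close>

lemma powr_above_tangent:
  fixes p x y :: real
  assumes "1 < p" "0 \<le> x" "0 \<le> y" "x \<noteq> y"
  shows "y powr p + p * y powr (p - 1) * (x - y) < x powr p"
proof (cases "x = 0 \<or> y = 0")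
  case True
  then show ?thesis
  proof
    assume "x = 0"
    then have "y > 0"
      using assms by simp
    have "y powr (p - 1) * y = y powr p"
      using powr_mult_base[of y "p - 1"] \<open>y > 0\<close> by (simp add: mult.commute)
    then have "p * y powr (p - 1) * (x - y) = - (p * y powr p)"
      using \<open>x = 0\<close> by simp
    moreover have "1 * y powr p < p * y powr p"
      using assms \<open>y > 0\<close> by (intro mult_strict_right_mono) auto
    moreover have "x powr p = 0"
      using \<open>x = 0\<close> by simp
    ultimately show ?thesis
      by linarith
  next
    assume "y = 0"
    then show ?thesis
      using assms by simp
  qed
next
  case False
  then have pos: "x > 0" "y > 0"
    using assms by auto
  have deriv: "((\<lambda>u. u powr p) has_real_derivative p * u powr (p - 1)) (at u)" if "0 < u" for u
    using that by (auto intro!: derivative_eq_intros)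
  show ?thesis
  proof (cases "y < x")
    case True
    obtain z where z: "y < z" "x powr p - y powr p = (x - y) * (p * z powr (p - 1))"
      using MVT2[OF True, of "\<lambda>u. u powr p" "\<lambda>u. p * u powr (p - 1)"] deriv pos by force
    have "y powr (p - 1) < z powr (p - 1)"
      using z pos assms by (intro powr_less_mono2) auto
    then have "(x - y) * (p * y powr (p - 1)) < (x - y) * (p * z powr (p - 1))"
      using True assms by (intro mult_strict_left_mono) auto
    then show ?thesis
      using z by (simp add: mult.commute)
  next
    case False
    then have "x < y"
      using assms by simp
    obtain z where z: "x < z" "z < y" "y powr p - x powr p = (y - x) * (p * z powr (p - 1))"
      using MVT2[OF \<open>x < y\<close>, of "\<lambda>u. u powr p" "\<lambda>u. p * u powr (p - 1)"] deriv pos by force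
    have "z powr (p - 1) < y powr (p - 1)"
      using z pos assms by (intro powr_less_mono2) auto
    then have "(y - x) * (p * z powr (p - 1)) < (y - x) * (p * y powr (p - 1))"
      using \<open>x < y\<close> assms by (intro mult_strict_left_mono) auto
    then show ?thesis
      using z by (simp add: algebra_simps)
  qed
qed

lemma powr_above_tangent_weak:
  fixes p x y :: real
  assumes "1 < p" "0 \<le> x" "0 \<le> y"
  shows "y powr p + p * y powr (p - 1) * (x - y) \<le> x powr p"
  using powr_above_tangent[OF assms] by (cases "x = y") auto

text \<open>Extensional functions form a full product once every index outside \<open>I\<close>
  carries the singleton \<open>{undefined}\<close>; Tychonoff's theorem then applies.\<close>

lemma compact_PiE:
  fixes S :: "'i \<Rightarrow> 'a::topological_space set"
  assumes "\<And>i. i \<in> I \<Longrightarrow> compact (S i)"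
  shows "compact (PiE I S)"
proof -
  have "PiE I S = PiE UNIV (\<lambda>i. if i \<in> I then S i else {undefined})"
    by (auto simp: PiE_iff extensional_def split: if_splits)
  moreover have "compactin (product_topology (\<lambda>i. euclidean) UNIV)
      (PiE UNIV (\<lambda>i. if i \<in> I then S i else {undefined}))"
    using assms by (auto simp: compactin_PiE)
  ultimately show ?thesis
    by (simp add: euclidean_product_topology)
qed

lemma continuous_on_Max:
  fixes f :: "'i \<Rightarrow> 'a::topological_space \<Rightarrow> 'b::linorder_topology"
  assumes "finite I" "I \<noteq> {}" "\<And>i. i \<in> I \<Longrightarrow> continuous_on S (f i)"
  shows "continuous_on S (\<lambda>x. Max ((\<lambda>i. f i x) ` I))"
  using assms
proof (induction rule: finite_ne_induct)
  case (insert i I)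
  then show ?case
    by (auto intro!: continuous_on_max)
qed simp

lemma minimum_eqI:
  assumes "is_arg_min f (\<lambda>x. x \<in> S) x"
  shows "minimum f S = f x"
  unfolding minimum_def using assms
  by (intro Least_equality) (auto simp: is_arg_min_linorder)

section \<open>Usage matrices and weak duality\<close>

text \<open>The duality depends on the paths only through a finite nonnegative matrix with a
  positive entry in every row. It is developed at this generality, and the temporal structure enters
  only when these assumptions are verified.\<close>

locale usage_family =
  fixes E :: "'e set" and \<Gamma> :: "'g set" and N :: "'g \<Rightarrow> 'e \<Rightarrow> real"
  assumes finite_E: "finite E" and finite_\<Gamma>: "finite \<Gamma>" and \<Gamma>_nonempty: "\<Gamma> \<noteq> {}"
    and N_nonneg: "\<And>\<gamma> e. \<gamma> \<in> \<Gamma> \<Longrightarrow> e \<in> E \<Longrightarrow> 0 \<le> N \<gamma> e"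
    and N_pos: "\<And>\<gamma>. \<gamma> \<in> \<Gamma> \<Longrightarrow> \<exists>e\<in>E. 0 < N \<gamma> e"
begin

abbreviation usage :: "('g \<Rightarrow> real) \<Rightarrow> 'e \<Rightarrow> real" where
  "usage \<equiv> expected_usage E N \<Gamma>"

lemma E_nonempty: "E \<noteq> {}"
  using N_pos \<Gamma>_nonempty by blast

lemma usage_nonneg:
  assumes "\<mu> \<in> mass_functions \<Gamma>" "e \<in> E"
  shows "0 \<le> usage \<mu> e"
proof -
  have "\<And>\<gamma>. \<gamma> \<in> \<Gamma> \<Longrightarrow> 0 \<le> \<mu> \<gamma>"
    using assms by (auto simp: mass_functions_def dest: PiE_mem)
  then show ?thesis
    using assms by (auto simp: expected_usage_def N_nonneg intro!: sum_nonneg)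
qed

text \<open>Total mass 1 puts positive mass on some path, and that path has an edge of positive
  usage. This excludes zero energies, by which later formulas divide.\<close>

lemma usage_pos:
  assumes "\<mu> \<in> mass_functions \<Gamma>"
  obtains e where "e \<in> E" "0 < usage \<mu> e"
proof -
  have nonneg: "\<And>\<gamma>. \<gamma> \<in> \<Gamma> \<Longrightarrow> 0 \<le> \<mu> \<gamma>" and "sum \<mu> \<Gamma> \<noteq> 0"
    using assms by (auto simp: mass_functions_def dest: PiE_mem)
  then obtain \<gamma> where \<gamma>: "\<gamma> \<in> \<Gamma>" "\<mu> \<gamma> \<noteq> 0"
    using sum.not_neutral_contains_not_neutral by blast
  then obtain e where e: "e \<in> E" "0 < N \<gamma> e"
    using N_pos by blast
  have "0 < N \<gamma> e * \<mu> \<gamma>"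
    using nonneg[of \<gamma>] \<gamma> e by (simp add: less_le)
  also have "\<dots> \<le> usage \<mu> e"
    unfolding expected_usage_def using e \<gamma> nonneg finite_\<Gamma>
    by (auto intro!: member_le_sum simp: N_nonneg)
  finally show ?thesis
    using e that by blast
qed

text \<open>Interchanging the two finite sums moves the matrix from \<mu> to \<rho>, as for a
  transpose.\<close>

lemma sum_usage_eq:
  "(\<Sum>e\<in>E. usage \<mu> e * \<rho> e) = (\<Sum>\<gamma>\<in>\<Gamma>. \<mu> \<gamma> * rho_length E N \<rho> \<gamma>)"
proof -
  have "(\<Sum>e\<in>E. usage \<mu> e * \<rho> e) = (\<Sum>e\<in>E. \<Sum>\<gamma>\<in>\<Gamma>. \<mu> \<gamma> * (N \<gamma> e * \<rho> e))"
    by (intro sum.cong) (simp_all add: expected_usage_def sum_distrib_right mult.assoc mult.left_commute)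
  then show ?thesis
    by (simp add: sum.swap[of _ E] rho_length_def sum_distrib_left)
qed

text \<open>By \<open>sum_usage_eq\<close> the pairing is a weighted mean of path lengths, each of
  which is at least 1.\<close>

lemma weak_duality:
  assumes "\<mu> \<in> mass_functions \<Gamma>" "\<rho> \<in> Adm E N \<Gamma>"
  shows "1 \<le> (\<Sum>e\<in>E. usage \<mu> e * \<rho> e)"
proof -
  have "(\<Sum>\<gamma>\<in>\<Gamma>. \<mu> \<gamma> * 1) \<le> (\<Sum>\<gamma>\<in>\<Gamma>. \<mu> \<gamma> * rho_length E N \<rho> \<gamma>)"
    using assms by (intro sum_mono mult_left_mono)
      (auto simp: mass_functions_def Adm_def dest: PiE_mem)
  then show ?thesis
    using assms by (simp add: sum_usage_eq mass_functions_def)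
qed

lemma Adm_nonneg: "\<rho> \<in> Adm E N \<Gamma> \<Longrightarrow> e \<in> E \<Longrightarrow> 0 \<le> \<rho> e"
  by (auto simp: Adm_def dest: PiE_mem)

lemma point_mass:
  assumes "\<gamma> \<in> \<Gamma>"
  shows "(\<lambda>g\<in>\<Gamma>. if g = \<gamma> then 1 else 0) \<in> mass_functions \<Gamma>"
    and "usage (\<lambda>g\<in>\<Gamma>. if g = \<gamma> then 1 else 0) = restrict (N \<gamma>) E"
  using assms finite_\<Gamma>
  by (auto simp: mass_functions_def expected_usage_def mult_delta_right cong: sum.cong)

section \<open>Existence of optimal mass functions\<close>

text \<open>Nonnegative masses with total 1 cannot exceed 1, so the simplex is a closed slice of a
  compact cube.\<close>

lemma compact_mass_functions: "compact (mass_functions \<Gamma>)"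
proof -
  have "\<mu> \<gamma> \<le> 1" if "\<mu> \<in> \<Gamma> \<rightarrow>\<^sub>E {0..}" "sum \<mu> \<Gamma> = 1" "\<gamma> \<in> \<Gamma>" for \<mu> :: "'g \<Rightarrow> real" and \<gamma>
    using member_le_sum[of \<gamma> \<Gamma> \<mu>] that finite_\<Gamma> by (auto dest: PiE_mem)
  then have "mass_functions \<Gamma> = (\<Gamma> \<rightarrow>\<^sub>E {0..1}) \<inter> {\<mu>. (\<Sum>\<gamma>\<in>\<Gamma>. \<mu> \<gamma>) = 1}"
    unfolding mass_functions_def by (auto simp: PiE_iff extensional_def)
  moreover have "closed {\<mu> :: 'g \<Rightarrow> real. (\<Sum>\<gamma>\<in>\<Gamma>. \<mu> \<gamma>) = 1}"
    by (intro closed_Collect_eq continuous_on_sum) auto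
  ultimately show ?thesis
    by (simp add: compact_Int_closed compact_PiE)
qed

lemma mass_attains_min:
  fixes f :: "('g \<Rightarrow> real) \<Rightarrow> real"
  assumes "continuous_on (mass_functions \<Gamma>) f"
  shows "\<exists>\<mu>. is_arg_min f (\<lambda>\<mu>. \<mu> \<in> mass_functions \<Gamma>) \<mu>"
proof -
  have "mass_functions \<Gamma> \<noteq> {}"
    using point_mass(1) \<Gamma>_nonempty by blast
  then show ?thesis
    using continuous_attains_inf[OF compact_mass_functions _ assms]
    by (auto simp: is_arg_min_linorder)
qed

lemma continuous_on_usage:
  "e \<in> E \<Longrightarrow> continuous_on S (\<lambda>\<mu>. usage \<mu> e)"
  unfolding expected_usage_def
  by (auto intro!: continuous_intros continuous_on_subset[OF continuous_on_product_coordinates])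

text \<open>Usages may vanish; \<open>powr\<close> is still continuous along them because they are
  nonnegative and the exponent is positive.\<close>

lemma ex_optimal_mass:
  assumes "0 < q"
  shows "\<exists>\<mu>. optimal_mass E N (ereal q) w \<Gamma> \<mu>"
  unfolding optimal_mass_def energy_def using assms
  by (intro mass_attains_min)
    (auto intro!: continuous_intros continuous_on_powr' continuous_on_usage usage_nonneg)

lemma ex_optimal_mass_infinity:
  "\<exists>\<mu>. optimal_mass E N \<infinity> w \<Gamma> \<mu>"
  unfolding optimal_mass_def energy_def using finite_E E_nonempty
  by (intro mass_attains_min)
    (auto intro!: continuous_intros continuous_on_Max continuous_on_usage)

section \<open>Duality for exponents strictly between 1 and infinity\<close>

lemma energy_usage_pos:
  assumes "\<mu> \<in> mass_functions \<Gamma>" and w: "\<And>e. e \<in> E \<Longrightarrow> 0 < w e"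
  shows "0 < energy E (ereal q) w (usage \<mu>)"
proof -
  obtain e where "e \<in> E" "0 < usage \<mu> e"
    using usage_pos assms by blast
  then show ?thesis
    using finite_E w by (auto simp: energy_def less_imp_le intro!: sum_pos2[of E e])
qed

text \<open>
  Compare the optimal \<open>\<mu>\<close> with \<open>(1 - h) \<mu> + h \<delta>\<^sub>\<gamma>\<close> and let \<open>h\<close> tend to 0. Convexity is used
  at the perturbed point, so that no differentiation at a vanishing usage is necessary.
\<close>

lemma optimal_mass_variation:
  assumes q: "1 < q" and w: "\<And>e. e \<in> E \<Longrightarrow> 0 < w e"
    and opt: "optimal_mass E N (ereal q) w \<Gamma> \<mu>" and \<gamma>: "\<gamma> \<in> \<Gamma>"
  shows "energy E (ereal q) w (usage \<mu>) \<le> (\<Sum>e\<in>E. w e * usage \<mu> e powr (q - 1) * N \<gamma> e)"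
proof -
  define \<eta> where "\<eta> = usage \<mu>"
  define \<nu> where "\<nu> h = (\<lambda>g\<in>\<Gamma>. (1 - h) * \<mu> g + (if g = \<gamma> then h else 0))" for h
  define \<zeta> where "\<zeta> h e = \<eta> e + h * (N \<gamma> e - \<eta> e)" for h e
  have \<mu>: "\<mu> \<in> mass_functions \<Gamma>"
    and min: "\<And>\<nu>. \<nu> \<in> mass_functions \<Gamma> \<Longrightarrow>
      energy E (ereal q) w \<eta> \<le> energy E (ereal q) w (usage \<nu>)"
    using opt by (auto simp: optimal_mass_def is_arg_min_linorder \<eta>_def)
  have \<nu>: "\<nu> h \<in> mass_functions \<Gamma>" if "0 < h" "h \<le> 1" for h
  proof -
    have "0 \<le> \<mu> g" if "g \<in> \<Gamma>" for g
      using \<mu> that by (auto simp: mass_functions_def dest: PiE_mem)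
    moreover have "(\<Sum>g\<in>\<Gamma>. (1 - h) * \<mu> g + (if g = \<gamma> then h else 0)) = 1"
      using \<mu> \<gamma> finite_\<Gamma>
      by (simp add: sum.distrib mass_functions_def flip: sum_distrib_left)
    ultimately show ?thesis
      using that by (auto simp: \<nu>_def mass_functions_def)
  qed
  have usage_\<nu>: "usage (\<nu> h) e = \<zeta> h e" if "e \<in> E" for h e
  proof -
    have "(\<Sum>g\<in>\<Gamma>. N g e * ((1 - h) * \<mu> g + (if g = \<gamma> then h else 0)))
        = (\<Sum>g\<in>\<Gamma>. (1 - h) * (N g e * \<mu> g) + (if g = \<gamma> then h * N g e else 0))"
      by (intro sum.cong) (auto simp: algebra_simps)
    also have "\<dots> = (1 - h) * \<eta> e + h * N \<gamma> e"
      using that \<gamma> finite_\<Gamma>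
      by (simp add: sum.distrib \<eta>_def expected_usage_def flip: sum_distrib_left)
    finally show ?thesis
      using that by (simp add: expected_usage_def \<nu>_def \<zeta>_def algebra_simps)
  qed
  \<comment> \<open>The tangent to the q-energy at \<open>\<zeta> h\<close>, evaluated at \<eta>,
    lies below the energy of \<eta>, which by minimality is at most that of
    \<open>\<zeta> h\<close>. The energies of \<open>\<zeta> h\<close> cancel and leave
    \<open>q * h\<close> times the claimed sum.\<close>
  have step: "0 \<le> (\<Sum>e\<in>E. w e * \<zeta> h e powr (q - 1) * (N \<gamma> e - \<eta> e))" if h: "0 < h" "h \<le> 1" for h
  proof -
    have "w e * \<zeta> h e powr q - q * h * (w e * \<zeta> h e powr (q - 1) * (N \<gamma> e - \<eta> e))
        \<le> w e * \<eta> e powr q" if "e \<in> E" for e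
    proof -
      have "0 \<le> \<zeta> h e" "0 \<le> \<eta> e"
        using usage_nonneg[OF \<nu>[OF h] that] usage_nonneg[OF \<mu> that] usage_\<nu>[OF that]
        by (auto simp: \<eta>_def)
      then have "\<zeta> h e powr q + q * \<zeta> h e powr (q - 1) * (\<eta> e - \<zeta> h e) \<le> \<eta> e powr q"
        using q by (intro powr_above_tangent_weak)
      from mult_left_mono[OF this less_imp_le[OF w[OF that]]] show ?thesis
        by (simp add: \<zeta>_def algebra_simps)
    qed
    then have "(\<Sum>e\<in>E. w e * \<zeta> h e powr q) -
        q * h * (\<Sum>e\<in>E. w e * \<zeta> h e powr (q - 1) * (N \<gamma> e - \<eta> e)) \<le> (\<Sum>e\<in>E. w e * \<eta> e powr q)"
      unfolding sum_distrib_left sum_subtractf[symmetric] by (rule sum_mono)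
    also have "\<dots> \<le> (\<Sum>e\<in>E. w e * \<zeta> h e powr q)"
      using min[OF \<nu>[OF h]] by (simp add: energy_def usage_\<nu>)
    finally have "0 \<le> q * h * (\<Sum>e\<in>E. w e * \<zeta> h e powr (q - 1) * (N \<gamma> e - \<eta> e))"
      by simp
    moreover have "0 < q * h"
      using q h by simp
    ultimately show ?thesis
      by (auto simp: zero_le_mult_iff)
  qed
  \<comment> \<open>The positive exponent \<open>q - 1\<close> lets the limit pass through
    \<open>powr\<close> even on edges with \<open>\<eta> e = 0\<close>, where
    \<open>\<zeta> h e\<close> tends to 0 through nonnegative values.\<close>
  have "((\<lambda>h. \<Sum>e\<in>E. w e * \<zeta> h e powr (q - 1) * (N \<gamma> e - \<eta> e)) \<longlongrightarrow>
      (\<Sum>e\<in>E. w e * \<eta> e powr (q - 1) * (N \<gamma> e - \<eta> e))) (at_right 0)"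
  proof (intro tendsto_intros tendsto_powr')
    fix e assume "e \<in> E"
    show "((\<lambda>h. \<zeta> h e) \<longlongrightarrow> \<eta> e) (at_right 0)"
      unfolding \<zeta>_def by (auto intro!: tendsto_eq_intros)
    have "eventually (\<lambda>h. 0 \<le> \<zeta> h e) (at_right 0)"
      unfolding eventually_at_right_field
      using usage_nonneg[OF \<nu> \<open>e \<in> E\<close>] usage_\<nu>[OF \<open>e \<in> E\<close>]
      by (intro exI[of _ 1]) auto
    then show "\<eta> e \<noteq> 0 \<or> 0 < q - 1 \<and> (\<forall>\<^sub>F h in at_right 0. 0 \<le> \<zeta> h e)"
      using q by simp
  qed
  moreover have "eventually
      (\<lambda>h. 0 \<le> (\<Sum>e\<in>E. w e * \<zeta> h e powr (q - 1) * (N \<gamma> e - \<eta> e))) (at_right 0)"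
    unfolding eventually_at_right_field using step by (intro exI[of _ 1]) auto
  ultimately have "0 \<le> (\<Sum>e\<in>E. w e * \<eta> e powr (q - 1) * (N \<gamma> e - \<eta> e))"
    by (rule tendsto_lowerbound) simp
  also have "\<dots> = (\<Sum>e\<in>E. w e * \<eta> e powr (q - 1) * N \<gamma> e) - (\<Sum>e\<in>E. w e * \<eta> e powr q)"
    unfolding sum_subtractf[symmetric]
  proof (intro sum.cong refl)
    fix e assume "e \<in> E"
    have "\<eta> e * \<eta> e powr (q - 1) = \<eta> e powr q"
      using powr_mult_base[of "\<eta> e" "q - 1"] usage_nonneg[OF \<mu> \<open>e \<in> E\<close>] by (simp add: \<eta>_def)
    then show "w e * \<eta> e powr (q - 1) * (N \<gamma> e - \<eta> e) =
        w e * \<eta> e powr (q - 1) * N \<gamma> e - w e * \<eta> e powr q"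
      by (simp add: algebra_simps)
  qed
  finally show ?thesis
    by (simp add: energy_def \<eta>_def)
qed

text \<open>The equality case of Hoelder's inequality: the gradient of the q-energy at \<eta>,
  divided by q and by the energy itself. The latter normalizes the pairing with \<eta> to 1.\<close>

definition dual_density :: "real \<Rightarrow> ('e \<Rightarrow> real) \<Rightarrow> ('e \<Rightarrow> real) \<Rightarrow> 'e \<Rightarrow> real" where
  "dual_density q w \<eta> = (\<lambda>e\<in>E. w e * \<eta> e powr (q - 1) / energy E (ereal q) w \<eta>)"

text \<open>After multiplication by the energy, the length condition for a path is the inequality of
  \<open>optimal_mass_variation\<close> for that path.\<close>

lemma dual_density_Adm:
  assumes q: "1 < q" and w: "\<And>e. e \<in> E \<Longrightarrow> 0 < w e"
    and opt: "optimal_mass E N (ereal q) w \<Gamma> \<mu>"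
  shows "dual_density q w (usage \<mu>) \<in> Adm E N \<Gamma>"
proof -
  let ?A = "energy E (ereal q) w (usage \<mu>)"
  have A: "0 < ?A"
    using opt w by (auto simp: optimal_mass_def is_arg_min_linorder intro: energy_usage_pos)
  have "1 \<le> rho_length E N (dual_density q w (usage \<mu>)) \<gamma>" if "\<gamma> \<in> \<Gamma>" for \<gamma>
  proof -
    have "rho_length E N (dual_density q w (usage \<mu>)) \<gamma> =
        (\<Sum>e\<in>E. w e * usage \<mu> e powr (q - 1) * N \<gamma> e) / ?A"
      unfolding rho_length_def sum_divide_distrib
      by (intro sum.cong) (auto simp: dual_density_def)
    then show ?thesis
      using optimal_mass_variation[OF q w opt that] A by simp
  qed
  moreover have "dual_density q w (usage \<mu>) \<in> E \<rightarrow>\<^sub>E {0..}"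
    using A w by (auto simp: dual_density_def less_imp_le)
  ultimately show ?thesis
    by (simp add: Adm_def)
qed

text \<open>Multiplying the usage by its (q-1)-th power makes the numerator the energy again. Weak
  duality is thus tight at the dual density.\<close>

lemma sum_usage_dual_density:
  assumes "\<mu> \<in> mass_functions \<Gamma>" and "\<And>e. e \<in> E \<Longrightarrow> 0 < w e"
  shows "(\<Sum>e\<in>E. usage \<mu> e * dual_density q w (usage \<mu>) e) = 1"
proof -
  let ?A = "energy E (ereal q) w (usage \<mu>)"
  have "(\<Sum>e\<in>E. usage \<mu> e * dual_density q w (usage \<mu>) e) = (\<Sum>e\<in>E. w e * usage \<mu> e powr q) / ?A"
    unfolding sum_divide_distrib
  proof (intro sum.cong refl)
    fix e assume "e \<in> E"
    then have "usage \<mu> e * usage \<mu> e powr (q - 1) = usage \<mu> e powr q"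
      using powr_mult_base[of "usage \<mu> e" "q - 1"] usage_nonneg[OF assms(1)] by simp
    then show "usage \<mu> e * dual_density q w (usage \<mu>) e = w e * usage \<mu> e powr q / ?A"
      using \<open>e \<in> E\<close> by (simp add: dual_density_def mult.left_commute)
  qed
  then show ?thesis
    using energy_usage_pos[where q = q and w = w, OF assms] by (simp add: energy_def)
qed
text \<open>Summing \<open>e1\<close> gives the energy, and dividing by it the share of each edge.
  By \<open>e2\<close> the gradient of the p-energy at \<open>\<rho>\<^sub>0\<close> is a positive
  multiple of \<eta>. The linear term of the tangent inequality is therefore nonnegative in total,
  since the pairing with \<eta> is at least 1 for \<rho> and equal to 1 for
  \<open>\<rho>\<^sub>0\<close>.\<close>

lemma
  assumes p: "1 < p" and q: "q = p / (p - 1)" and \<sigma>: "\<And>e. e \<in> E \<Longrightarrow> 0 < \<sigma> e"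
    and \<sigma>': "\<sigma>' = (\<lambda>e. \<sigma> e powr (- q / p))"
    and opt: "optimal_mass E N (ereal q) \<sigma>' \<Gamma> \<mu>"
  shows energy_dual_density: "energy E (ereal p) \<sigma> (dual_density q \<sigma>' (usage \<mu>)) =
      energy E (ereal q) \<sigma>' (usage \<mu>) powr (- p / q)"
    and dual_density_energy_share: "e \<in> E \<Longrightarrow>
      \<sigma> e * dual_density q \<sigma>' (usage \<mu>) e powr p /
        energy E (ereal p) \<sigma> (dual_density q \<sigma>' (usage \<mu>)) =
      \<sigma>' e * usage \<mu> e powr q / energy E (ereal q) \<sigma>' (usage \<mu>)"
    and dual_density_unique_min: "\<rho> \<in> Adm E N \<Gamma> \<Longrightarrow> \<rho> \<noteq> dual_density q \<sigma>' (usage \<mu>) \<Longrightarrow>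
      energy E (ereal p) \<sigma> (dual_density q \<sigma>' (usage \<mu>)) < energy E (ereal p) \<sigma> \<rho>"
proof -
  define \<eta> where "\<eta> = usage \<mu>"
  define A where "A = energy E (ereal q) \<sigma>' \<eta>"
  define \<rho>\<^sub>0 where "\<rho>\<^sub>0 = dual_density q \<sigma>' \<eta>"
  have \<mu>: "\<mu> \<in> mass_functions \<Gamma>"
    using opt by (simp add: optimal_mass_def is_arg_min_linorder)
  have "1 < q"
    using p by (simp add: q less_divide_eq)
  have exps: "- p / q = 1 - p"
    using p by (simp add: q)
  have w: "0 < \<sigma>' e" if "e \<in> E" for e
    using \<sigma>[OF that] by (simp add: \<sigma>')
  have A: "0 < A"
    unfolding A_def \<eta>_def using \<mu> w by (rule energy_usage_pos)
  have \<rho>\<^sub>0: "\<rho>\<^sub>0 \<in> Adm E N \<Gamma>"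
    unfolding \<rho>\<^sub>0_def \<eta>_def using \<open>1 < q\<close> w opt by (rule dual_density_Adm)
  have edge: "\<rho>\<^sub>0 e = \<sigma>' e * \<eta> e powr (q - 1) / A" "0 \<le> \<eta> e" if "e \<in> E" for e
    using that usage_nonneg[OF \<mu> that] by (simp_all add: \<rho>\<^sub>0_def dual_density_def A_def \<eta>_def)
  have e1: "\<sigma> e * \<rho>\<^sub>0 e powr p = \<sigma>' e * \<eta> e powr q * A powr - p"
    and e2: "\<sigma> e * \<rho>\<^sub>0 e powr (p - 1) = \<eta> e * A powr (1 - p)" if "e \<in> E" for e
    unfolding edge[OF that]
    using conjugate_powr[OF p q \<sigma>[OF that] edge(2)[OF that] A] by (simp_all add: \<sigma>')
  have energy: "energy E (ereal p) \<sigma> \<rho>\<^sub>0 = A powr (1 - p)"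
  proof -
    have "energy E (ereal p) \<sigma> \<rho>\<^sub>0 = A * A powr - p"
      by (simp add: energy_def e1 A_def flip: sum_distrib_right)
    then show ?thesis
      using A powr_mult_base[of A "- p"] by simp
  qed
  then show "energy E (ereal p) \<sigma> (dual_density q \<sigma>' (usage \<mu>)) =
      energy E (ereal q) \<sigma>' (usage \<mu>) powr (- p / q)"
    unfolding exps by (simp add: A_def \<eta>_def \<rho>\<^sub>0_def)
  show "\<sigma> e * dual_density q \<sigma>' (usage \<mu>) e powr p /
        energy E (ereal p) \<sigma> (dual_density q \<sigma>' (usage \<mu>)) =
      \<sigma>' e * usage \<mu> e powr q / energy E (ereal q) \<sigma>' (usage \<mu>)" if "e \<in> E"
  proof -
    have "A powr (1 - p) = A powr (- p) * A"
      using A powr_mult_base[of A "- p"] by (simp add: mult.commute)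
    then have "\<sigma> e * \<rho>\<^sub>0 e powr p / energy E (ereal p) \<sigma> \<rho>\<^sub>0 = \<sigma>' e * \<eta> e powr q / A"
      using A by (simp add: energy e1[OF that])
    then show ?thesis
      by (simp add: A_def \<eta>_def \<rho>\<^sub>0_def)
  qed
  show "energy E (ereal p) \<sigma> (dual_density q \<sigma>' (usage \<mu>)) < energy E (ereal p) \<sigma> \<rho>"
    if \<rho>: "\<rho> \<in> Adm E N \<Gamma>" and neq: "\<rho> \<noteq> dual_density q \<sigma>' (usage \<mu>)"
  proof -
    \<comment> \<open>\<open>?t e\<close> is the tangent at \<open>\<rho>\<^sub>0 e\<close>,
      evaluated at \<open>\<rho> e\<close>, with the slope rewritten by \<open>e2\<close> so that
      the usage appears.\<close>
    let ?t = "\<lambda>e. \<sigma> e * \<rho>\<^sub>0 e powr p + p * A powr (1 - p) * (\<eta> e * (\<rho> e - \<rho>\<^sub>0 e))"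
    have tangent: "?t e = \<sigma> e * (\<rho>\<^sub>0 e powr p + p * \<rho>\<^sub>0 e powr (p - 1) * (\<rho> e - \<rho>\<^sub>0 e))" if "e \<in> E" for e
      using arg_cong[OF e2[OF that], of "\<lambda>x. p * x * (\<rho> e - \<rho>\<^sub>0 e)"] by (simp add: algebra_simps)
    \<comment> \<open>Densities are extensional, so two different ones differ at an edge of
      \<open>E\<close>; strictness there makes the summed inequality strict.\<close>
    have "\<exists>e\<in>E. \<rho> e \<noteq> \<rho>\<^sub>0 e"
    proof (rule ccontr)
      assume "\<not> (\<exists>e\<in>E. \<rho> e \<noteq> \<rho>\<^sub>0 e)"
      moreover have "\<rho> \<in> extensional E" "\<rho>\<^sub>0 \<in> extensional E"
        using \<rho> \<rho>\<^sub>0 by (auto simp: Adm_def PiE_iff)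
      ultimately have "\<rho> = \<rho>\<^sub>0"
        by (intro extensionalityI[of _ E]) auto
      then show False
        using neq by (simp add: \<rho>\<^sub>0_def \<eta>_def)
    qed
    then obtain e where e: "e \<in> E" "\<rho> e \<noteq> \<rho>\<^sub>0 e" by blast
    have "(\<Sum>e\<in>E. ?t e) < (\<Sum>e\<in>E. \<sigma> e * \<rho> e powr p)"
    proof (rule sum_strict_mono_ex1)
      show "\<forall>e\<in>E. ?t e \<le> \<sigma> e * \<rho> e powr p"
        using powr_above_tangent_weak[OF p Adm_nonneg[OF \<rho>] Adm_nonneg[OF \<rho>\<^sub>0]] \<sigma>
        by (simp add: tangent mult_left_mono less_imp_le)
      have "?t e < \<sigma> e * \<rho> e powr p"
        using powr_above_tangent[OF p Adm_nonneg[OF \<rho>] Adm_nonneg[OF \<rho>\<^sub>0]] \<sigma> e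
        by (simp add: tangent)
      then show "\<exists>e\<in>E. ?t e < \<sigma> e * \<rho> e powr p"
        using e by blast
    qed (rule finite_E)
    moreover have "0 \<le> (\<Sum>e\<in>E. \<eta> e * (\<rho> e - \<rho>\<^sub>0 e))"
      using weak_duality[OF \<mu> \<rho>] sum_usage_dual_density[where q = q and w = \<sigma>', OF \<mu> w]
      by (simp add: right_diff_distrib sum_subtractf \<eta>_def \<rho>\<^sub>0_def)
    then have "0 \<le> p * A powr (1 - p) * (\<Sum>e\<in>E. \<eta> e * (\<rho> e - \<rho>\<^sub>0 e))"
      using p by simp
    ultimately show ?thesis
      by (simp add: energy_def sum.distrib \<rho>\<^sub>0_def \<eta>_def flip: sum_distrib_left)
  qed
qed

text \<open>Existence and uniqueness of the optimal density, the value of the modulus and the edge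
  shares all follow from \<open>opt_iff\<close>; uniqueness of \<eta> is then read back from the
  shares.\<close>

lemma p_duality:
  assumes p: "1 < p" and q: "q = p / (p - 1)" and \<sigma>_pos: "\<forall>e\<in>E. 0 < \<sigma> e"
    and \<sigma>': "\<sigma>' = (\<lambda>e. \<sigma> e powr (- q / p))"
  shows "Modulus E N (ereal p) \<sigma> \<Gamma> =
      minimum (\<lambda>\<mu>. energy E (ereal q) \<sigma>' (usage \<mu>)) (mass_functions \<Gamma>) powr (- p / q)"
    and "\<exists>!\<rho>. optimal_density E N (ereal p) \<sigma> \<Gamma> \<rho>"
    and "\<exists>\<mu>. optimal_mass E N (ereal q) \<sigma>' \<Gamma> \<mu>"
    and "\<exists>!\<eta>. \<exists>\<mu>. optimal_mass E N (ereal q) \<sigma>' \<Gamma> \<mu> \<and> \<eta> = usage \<mu>"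
    and "\<And>\<rho> \<mu> e. optimal_density E N (ereal p) \<sigma> \<Gamma> \<rho> \<Longrightarrow>
      optimal_mass E N (ereal q) \<sigma>' \<Gamma> \<mu> \<Longrightarrow> e \<in> E \<Longrightarrow>
      \<sigma> e * \<rho> e powr p / energy E (ereal p) \<sigma> \<rho> =
      \<sigma>' e * usage \<mu> e powr q / energy E (ereal q) \<sigma>' (usage \<mu>)"
proof -
  note \<sigma> = \<sigma>_pos[rule_format]
  have "1 < q"
    using p by (simp add: q less_divide_eq)
  have w: "0 < \<sigma>' e" if "e \<in> E" for e
    using \<sigma>[OF that] by (simp add: \<sigma>')
  \<comment> \<open>The equivalence holds for every optimal \<mu>, so all optimal masses have the
    same dual density.\<close>
  have opt_iff: "optimal_density E N (ereal p) \<sigma> \<Gamma> \<rho> \<longleftrightarrow> \<rho> = dual_density q \<sigma>' (usage \<mu>)"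
    if "optimal_mass E N (ereal q) \<sigma>' \<Gamma> \<mu>" for \<rho> \<mu>
    using dual_density_Adm[OF \<open>1 < q\<close> w that] dual_density_unique_min[OF p q \<sigma> \<sigma>' that]
    by (auto simp: optimal_density_def is_arg_min_def) (metis less_asym)
  show ex: "\<exists>\<mu>. optimal_mass E N (ereal q) \<sigma>' \<Gamma> \<mu>"
    using \<open>1 < q\<close> by (intro ex_optimal_mass) simp
  then obtain \<mu> where \<mu>: "optimal_mass E N (ereal q) \<sigma>' \<Gamma> \<mu>" ..
  show "\<exists>!\<rho>. optimal_density E N (ereal p) \<sigma> \<Gamma> \<rho>"
    using opt_iff[OF \<mu>] by simp
  have "Modulus E N (ereal p) \<sigma> \<Gamma> = energy E (ereal p) \<sigma> (dual_density q \<sigma>' (usage \<mu>))"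
    unfolding Modulus_def using opt_iff[OF \<mu>]
    by (intro minimum_eqI) (simp add: optimal_density_def)
  moreover have "minimum (\<lambda>\<mu>. energy E (ereal q) \<sigma>' (usage \<mu>)) (mass_functions \<Gamma>) =
      energy E (ereal q) \<sigma>' (usage \<mu>)"
    using \<mu> by (intro minimum_eqI) (simp add: optimal_mass_def)
  ultimately show "Modulus E N (ereal p) \<sigma> \<Gamma> =
      minimum (\<lambda>\<mu>. energy E (ereal q) \<sigma>' (usage \<mu>)) (mass_functions \<Gamma>) powr (- p / q)"
    using energy_dual_density[OF p q \<sigma> \<sigma>' \<mu>] by simp
  show share: "\<sigma> e * \<rho> e powr p / energy E (ereal p) \<sigma> \<rho> =
      \<sigma>' e * usage \<mu> e powr q / energy E (ereal q) \<sigma>' (usage \<mu>)"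
    if "optimal_density E N (ereal p) \<sigma> \<Gamma> \<rho>" "optimal_mass E N (ereal q) \<sigma>' \<Gamma> \<mu>" "e \<in> E" for \<rho> \<mu> e
    using dual_density_energy_share[OF p q \<sigma> \<sigma>' that(2,3)] that(1)
    unfolding opt_iff[OF that(2)] by simp
  \<comment> \<open>Two optimal masses have the same minimal energy and, through the common optimal
    density, the same edge shares. Cancelling the positive weight and energy leaves equal q-th
    powers, which determine nonnegative usages.\<close>
  have unique: "usage \<nu> = usage \<mu>" if \<nu>: "optimal_mass E N (ereal q) \<sigma>' \<Gamma> \<nu>" for \<nu>
  proof (rule extensionalityI)
    fix e assume e: "e \<in> E"
    let ?A = "\<lambda>\<mu>. energy E (ereal q) \<sigma>' (usage \<mu>)"
    have mass: "\<mu> \<in> mass_functions \<Gamma>" "\<nu> \<in> mass_functions \<Gamma>" and A: "?A \<mu> = ?A \<nu>"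
      using \<mu> \<nu> by (auto simp: optimal_mass_def is_arg_min_linorder intro: antisym)
    obtain \<rho> where "optimal_density E N (ereal p) \<sigma> \<Gamma> \<rho>"
      using opt_iff[OF \<mu>] by blast
    then have "\<sigma>' e * usage \<mu> e powr q / ?A \<mu> = \<sigma>' e * usage \<nu> e powr q / ?A \<nu>"
      using share \<mu> \<nu> e by metis
    then have "usage \<mu> e powr q = usage \<nu> e powr q"
      using A energy_usage_pos[where q = q and w = \<sigma>', OF mass(1) w] w[OF e] by simp
    then have "(usage \<mu> e powr q) powr (1 / q) = (usage \<nu> e powr q) powr (1 / q)"
      by simp
    then show "usage \<nu> e = usage \<mu> e"
      using \<open>1 < q\<close> usage_nonneg[OF mass(1) e] usage_nonneg[OF mass(2) e]
      by (simp add: powr_powr)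
  qed (auto simp: expected_usage_def)
  show "\<exists>!\<eta>. \<exists>\<mu>. optimal_mass E N (ereal q) \<sigma>' \<Gamma> \<mu> \<and> \<eta> = usage \<mu>"
  proof (rule ex1I[of _ "usage \<mu>"])
    show "\<exists>\<nu>. optimal_mass E N (ereal q) \<sigma>' \<Gamma> \<nu> \<and> usage \<mu> = usage \<nu>"
      by (intro exI[of _ \<mu>] conjI \<mu> refl)
    show "\<eta> = usage \<mu>" if "\<exists>\<nu>. optimal_mass E N (ereal q) \<sigma>' \<Gamma> \<nu> \<and> \<eta> = usage \<nu>" for \<eta>
      using that by (elim exE conjE) (drule unique, simp only:)
  qed
qed

section \<open>The exponents 1 and infinity\<close>

lemma energy_infinity_le_iff:
  "energy E \<infinity> w x \<le> c \<longleftrightarrow> (\<forall>e\<in>E. w e * x e \<le> c)"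
  using finite_E E_nonempty by (simp add: energy_def)

lemma energy_infinity_ge:
  "e \<in> E \<Longrightarrow> w e * x e \<le> energy E \<infinity> w x"
  using energy_infinity_le_iff[of w x "energy E \<infinity> w x"] by simp

text \<open>Nonnegativity turns \<open>x e powr 1\<close> into \<open>x e\<close>.\<close>

lemma energy_1:
  "(\<And>e. e \<in> E \<Longrightarrow> 0 \<le> x e) \<Longrightarrow> energy E 1 w x = (\<Sum>e\<in>E. w e * x e)"
  by (simp add: energy_def)

text \<open>Each \<open>x e\<close> is at most the maximum energy divided by
  \<open>\<sigma> e\<close>; this is weighted with the nonnegative \<open>y e\<close> and
  summed.\<close>

lemma energy_Hoelder_infinity:
  assumes "\<And>e. e \<in> E \<Longrightarrow> 0 < \<sigma> e" "\<And>e. e \<in> E \<Longrightarrow> 0 \<le> y e"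
  shows "(\<Sum>e\<in>E. x e * y e) \<le> energy E \<infinity> \<sigma> x * energy E 1 (\<lambda>e. 1 / \<sigma> e) y"
proof -
  have "x e * y e \<le> energy E \<infinity> \<sigma> x * (1 / \<sigma> e * y e)" if "e \<in> E" for e
  proof -
    have "x e \<le> energy E \<infinity> \<sigma> x / \<sigma> e"
      using energy_infinity_ge[OF that, of \<sigma> x] assms that by (simp add: field_simps)
    from mult_right_mono[OF this assms(2)[OF that]] show ?thesis
      by simp
  qed
  then have "(\<Sum>e\<in>E. x e * y e) \<le> (\<Sum>e\<in>E. energy E \<infinity> \<sigma> x * (1 / \<sigma> e * y e))"
    by (rule sum_mono)
  then show ?thesis
    using energy_1[of y] assms(2) by (simp add: sum_distrib_left)
qed

text \<open>Both bounds come from one Hoelder inequality, used for the weights \<sigma> and, with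
  the roles of density and usage exchanged, for the reciprocal weights.\<close>

lemma weak_duality_1_infinity:
  assumes \<sigma>: "\<And>e. e \<in> E \<Longrightarrow> 0 < \<sigma> e" and \<mu>: "\<mu> \<in> mass_functions \<Gamma>" and \<rho>: "\<rho> \<in> Adm E N \<Gamma>"
  shows "1 \<le> energy E \<infinity> \<sigma> \<rho> * energy E 1 (\<lambda>e. 1 / \<sigma> e) (usage \<mu>)"
    and "1 \<le> energy E 1 \<sigma> \<rho> * energy E \<infinity> (\<lambda>e. 1 / \<sigma> e) (usage \<mu>)"
  using weak_duality[OF \<mu> \<rho>]
    energy_Hoelder_infinity[of \<sigma> "usage \<mu>" \<rho>]
    energy_Hoelder_infinity[of "\<lambda>e. 1 / \<sigma> e" \<rho> "usage \<mu>"]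
    \<sigma> Adm_nonneg[OF \<rho>] usage_nonneg[OF \<mu>]
  by (simp_all add: mult.commute)

text \<open>A density proportional to \<open>1 / \<sigma>\<close> gives all terms
  \<open>\<sigma> e * \<rho> e\<close> the same value, as suits a maximum energy; dividing by a
  lower bound \<open>m\<close> of the lengths makes it admissible.\<close>

lemma uniform_density_Adm:
  assumes \<sigma>: "\<And>e. e \<in> E \<Longrightarrow> 0 < \<sigma> e"
    and m: "0 < m" "\<And>\<gamma>. \<gamma> \<in> \<Gamma> \<Longrightarrow> m \<le> rho_length E N (\<lambda>e. 1 / \<sigma> e) \<gamma>"
  shows "(\<lambda>e\<in>E. 1 / \<sigma> e / m) \<in> Adm E N \<Gamma>"
proof -
  have "rho_length E N (\<lambda>e\<in>E. 1 / \<sigma> e / m) \<gamma> = rho_length E N (\<lambda>e. 1 / \<sigma> e) \<gamma> / m" for \<gamma>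
    by (simp add: rho_length_def sum_divide_distrib)
  then show ?thesis
    using assms by (auto simp: Adm_def less_imp_le)
qed

lemma shortest_path:
  assumes \<sigma>: "\<And>e. e \<in> E \<Longrightarrow> 0 < \<sigma> e"
  obtains \<gamma> where "\<gamma> \<in> \<Gamma>" "0 < rho_length E N (\<lambda>e. 1 / \<sigma> e) \<gamma>"
    "\<And>g. g \<in> \<Gamma> \<Longrightarrow> rho_length E N (\<lambda>e. 1 / \<sigma> e) \<gamma> \<le> rho_length E N (\<lambda>e. 1 / \<sigma> e) g"
proof -
  obtain \<gamma> where \<gamma>: "is_arg_min (rho_length E N (\<lambda>e. 1 / \<sigma> e)) (\<lambda>\<gamma>. \<gamma> \<in> \<Gamma>) \<gamma>"
    using ex_is_arg_min_if_finite[OF finite_\<Gamma> \<Gamma>_nonempty] by blast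
  then have "\<gamma> \<in> \<Gamma>" by (simp add: is_arg_min_def)
  then obtain e where "e \<in> E" "0 < N \<gamma> e"
    using N_pos by blast
  then have "0 < rho_length E N (\<lambda>e. 1 / \<sigma> e) \<gamma>"
    unfolding rho_length_def using finite_E \<sigma> N_nonneg \<open>\<gamma> \<in> \<Gamma>\<close>
    by (intro sum_pos2[of E e]) (auto simp: less_imp_le)
  then show ?thesis
    using that \<gamma> by (auto simp: is_arg_min_linorder)
qed

text \<open>An explicit pair is tight: the point mass on a shortest path for the edge lengths
  \<open>1 / \<sigma>\<close>, and these edge lengths divided by the shortest length. The product of
  their energies is at most 1, so \<open>is_arg_min_of_product\<close> applies.\<close>

lemma infinity_duality:
  assumes \<sigma>: "\<And>e. e \<in> E \<Longrightarrow> 0 < \<sigma> e"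
  obtains \<rho> \<mu> where "optimal_density E N \<infinity> \<sigma> \<Gamma> \<rho>" "optimal_mass E N 1 (\<lambda>e. 1 / \<sigma> e) \<Gamma> \<mu>"
    "energy E \<infinity> \<sigma> \<rho> * energy E 1 (\<lambda>e. 1 / \<sigma> e) (usage \<mu>) = 1"
proof -
  let ?L = "rho_length E N (\<lambda>e. 1 / \<sigma> e)"
  obtain \<gamma> where \<gamma>: "\<gamma> \<in> \<Gamma>" "0 < ?L \<gamma>" and min: "\<And>g. g \<in> \<Gamma> \<Longrightarrow> ?L \<gamma> \<le> ?L g"
    using shortest_path \<sigma> by blast
  define \<rho> where "\<rho> = (\<lambda>e\<in>E. 1 / \<sigma> e / ?L \<gamma>)"
  define \<mu> :: "'g \<Rightarrow> real" where "\<mu> = (\<lambda>g\<in>\<Gamma>. if g = \<gamma> then 1 else 0)"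
  have \<rho>: "\<rho> \<in> Adm E N \<Gamma>"
    unfolding \<rho>_def using \<sigma> \<gamma>(2) min by (rule uniform_density_Adm)
  have \<mu>: "\<mu> \<in> mass_functions \<Gamma>" "usage \<mu> = restrict (N \<gamma>) E"
    unfolding \<mu>_def using point_mass \<gamma> by blast+
  have "energy E \<infinity> \<sigma> \<rho> \<le> 1 / ?L \<gamma>"
    unfolding energy_infinity_le_iff using \<sigma> by (force simp: \<rho>_def)
  moreover have energy_\<mu>: "energy E 1 (\<lambda>e. 1 / \<sigma> e) (usage \<mu>) = ?L \<gamma>"
    using energy_1[where x = "usage \<mu>", OF usage_nonneg[OF \<mu>(1)]] by (simp add: \<mu>(2) rho_length_def)
  ultimately have le: "energy E \<infinity> \<sigma> \<rho> * energy E 1 (\<lambda>e. 1 / \<sigma> e) (usage \<mu>) \<le> 1"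
    using \<gamma> by (simp add: field_simps)
  have "0 < energy E 1 (\<lambda>e. 1 / \<sigma> e) (usage \<mu>)"
    using energy_\<mu> \<gamma>(2) by simp
  moreover have "\<forall>a\<in>Adm E N \<Gamma>. \<forall>b\<in>mass_functions \<Gamma>.
      1 \<le> energy E \<infinity> \<sigma> a * energy E 1 (\<lambda>e. 1 / \<sigma> e) (usage b)"
    using weak_duality_1_infinity(1)[of \<sigma>] \<sigma> by blast
  ultimately show ?thesis
    using is_arg_min_of_product[of \<rho> "Adm E N \<Gamma>" \<mu> "mass_functions \<Gamma>"
        "energy E \<infinity> \<sigma>" "\<lambda>\<mu>. energy E 1 (\<lambda>e. 1 / \<sigma> e) (usage \<mu>)"] \<rho> \<mu>(1) le
    by (intro that) (auto simp: optimal_density_def optimal_mass_def)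
qed

text \<open>The admissible set is closed but unbounded. An admissible \<open>\<rho>\<^sub>0\<close>
  bounds the coordinates of all competitors, because no term of the linear energy exceeds the
  energy; hence a compact part suffices.\<close>

lemma ex_optimal_density_1:
  assumes \<sigma>: "\<And>e. e \<in> E \<Longrightarrow> 0 < \<sigma> e"
  shows "\<exists>\<rho>. optimal_density E N 1 \<sigma> \<Gamma> \<rho>"
proof -
  obtain \<rho>\<^sub>0 where \<rho>\<^sub>0: "\<rho>\<^sub>0 \<in> Adm E N \<Gamma>"
  proof -
    obtain \<gamma> where "0 < rho_length E N (\<lambda>e. 1 / \<sigma> e) \<gamma>"
      "\<And>g. g \<in> \<Gamma> \<Longrightarrow> rho_length E N (\<lambda>e. 1 / \<sigma> e) \<gamma> \<le> rho_length E N (\<lambda>e. 1 / \<sigma> e) g"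
      using shortest_path \<sigma> by blast
    with \<sigma> show thesis
      by (intro that[OF uniform_density_Adm])
  qed
  let ?F = "\<lambda>\<rho>. \<Sum>e\<in>E. \<sigma> e * \<rho> e"
  have F: "energy E 1 \<sigma> \<rho> = ?F \<rho>" and F_ge: "e \<in> E \<Longrightarrow> \<sigma> e * \<rho> e \<le> ?F \<rho>"
    if "\<rho> \<in> Adm E N \<Gamma>" for \<rho> e
    using Adm_nonneg[OF that] finite_E \<sigma>
    by (auto simp: energy_1 less_imp_le intro!: member_le_sum)
  define K where "K = (\<Pi>\<^sub>E e\<in>E. {0..?F \<rho>\<^sub>0 / \<sigma> e}) \<inter> (\<Inter>\<gamma>\<in>\<Gamma>. {\<rho>. 1 \<le> rho_length E N \<rho> \<gamma>})"
  have "closed (\<Inter>\<gamma>\<in>\<Gamma>. {\<rho>. 1 \<le> rho_length E N \<rho> \<gamma>})"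
    unfolding rho_length_def
    by (intro closed_INT ballI closed_Collect_le continuous_on_sum continuous_on_mult) auto
  then have "compact K"
    unfolding K_def by (intro compact_Int_closed compact_PiE) auto
  have K_iff: "\<rho> \<in> K \<longleftrightarrow> \<rho> \<in> Adm E N \<Gamma> \<and> (\<forall>e\<in>E. \<sigma> e * \<rho> e \<le> ?F \<rho>\<^sub>0)" for \<rho>
    using \<sigma> by (auto simp: K_def Adm_def PiE_iff field_simps)
  have "continuous_on K ?F"
    by (auto intro!: continuous_intros continuous_on_subset[OF continuous_on_product_coordinates])
  moreover have "\<rho>\<^sub>0 \<in> K"
    unfolding K_iff using \<rho>\<^sub>0 F_ge by blast
  ultimately obtain \<rho> where \<rho>: "\<rho> \<in> K" and min: "\<And>x. x \<in> K \<Longrightarrow> ?F \<rho> \<le> ?F x"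
    using continuous_attains_inf[OF \<open>compact K\<close>, of ?F] by blast
  \<comment> \<open>Outside \<open>K\<close> a single term already exceeds the energy of
    \<open>\<rho>\<^sub>0\<close>, which lies in \<open>K\<close>.\<close>
  have "?F \<rho> \<le> ?F x" if x: "x \<in> Adm E N \<Gamma>" for x
  proof (cases "x \<in> K")
    case False
    then obtain e where "e \<in> E" "?F \<rho>\<^sub>0 < \<sigma> e * x e"
      using x K_iff by force
    then show ?thesis
      using F_ge[OF x \<open>e \<in> E\<close>] min[OF \<open>\<rho>\<^sub>0 \<in> K\<close>] by linarith
  qed (rule min)
  then show ?thesis
    using \<rho> F by (auto simp: optimal_density_def is_arg_min_linorder K_iff)
qed

text \<open>
  A linear programming duality, obtained from the case of finite exponents: the densities dual to
  the optimal masses for the weights \<open>\<sigma>\<^sup>-\<^sup>q\<close> become optimal as \<open>q\<close> tends to infinity.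
\<close>

lemma near_optimal_density_1:
  assumes \<sigma>: "\<And>e. e \<in> E \<Longrightarrow> 0 < \<sigma> e" and q: "1 < q" and A: "0 < A"
    and le: "\<And>\<mu>. \<mu> \<in> mass_functions \<Gamma> \<Longrightarrow> A \<le> energy E \<infinity> (\<lambda>e. 1 / \<sigma> e) (usage \<mu>)"
  obtains \<rho> where "\<rho> \<in> Adm E N \<Gamma>" "energy E 1 \<sigma> \<rho> * A \<le> 1 + card E / q"
proof -
  \<comment> \<open>With these weights the q-energy of the usage is the sum of the q-th powers of
    \<open>1 / \<sigma> e * usage \<mu> e\<close>, which for large q is governed by the largest of
    these values.\<close>
  define w where "w e = (1 / \<sigma> e) powr q" for e
  have w: "0 < w e" if "e \<in> E" for e
    using \<sigma>[OF that] by (simp add: w_def)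
  obtain \<mu> where opt: "optimal_mass E N (ereal q) w \<Gamma> \<mu>"
    using ex_optimal_mass q by (metis less_trans zero_less_one)
  then have \<mu>: "\<mu> \<in> mass_functions \<Gamma>"
    by (simp add: optimal_mass_def is_arg_min_linorder)
  define x where "x e = 1 / \<sigma> e * usage \<mu> e" for e
  define M where "M = energy E \<infinity> (\<lambda>e. 1 / \<sigma> e) (usage \<mu>)"
  define F where "F = energy E (ereal q) w (usage \<mu>)"
  define \<rho> where "\<rho> = dual_density q w (usage \<mu>)"
  have \<rho>: "\<rho> \<in> Adm E N \<Gamma>"
    unfolding \<rho>_def using q w opt by (rule dual_density_Adm)
  have "0 < F"
    unfolding F_def using \<mu> w by (rule energy_usage_pos)
  have "A \<le> M"
    unfolding M_def using \<mu> by (rule le)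
  have x_nonneg: "0 \<le> x e" if "e \<in> E" for e
    using \<sigma>[OF that] usage_nonneg[OF \<mu> that] by (simp add: x_def)
  have F: "F = (\<Sum>e\<in>E. x e powr q)"
    using \<sigma> usage_nonneg[OF \<mu>]
    by (auto simp: F_def energy_def w_def x_def powr_mult powr_divide less_imp_le intro!: sum.cong)
  have \<rho>_eq: "\<sigma> e * \<rho> e = x e powr (q - 1) / F" if "e \<in> E" for e
  proof -
    have "\<sigma> e * w e = (1 / \<sigma> e) powr (q - 1)"
      using \<sigma>[OF that] by (simp add: w_def powr_diff)
    then have "\<sigma> e * w e * usage \<mu> e powr (q - 1) = x e powr (q - 1)"
      using \<sigma>[OF that] usage_nonneg[OF \<mu> that] by (simp only: x_def powr_mult)
    then show ?thesis
      using that by (simp add: \<rho>_def dual_density_def F_def mult.assoc)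
  qed
  have energy_\<rho>: "energy E 1 \<sigma> \<rho> = (\<Sum>e\<in>E. x e powr (q - 1)) / F"
    using energy_1[where x = \<rho>, OF Adm_nonneg[OF \<rho>]] by (simp add: \<rho>_eq sum_divide_distrib)
  \<comment> \<open>The maximum is one of the values \<open>x e\<close>, so the power sum
    \<open>F\<close> dominates \<open>M powr q\<close>.\<close>
  have "M \<in> x ` E"
    using Max_in[of "x ` E"] finite_E E_nonempty by (simp add: M_def energy_def x_def[abs_def])
  then obtain e where "e \<in> E" "M = x e"
    by blast
  then have "M powr q \<le> F"
    unfolding F using finite_E by (auto intro!: member_le_sum)
  \<comment> \<open>The tangent at \<open>x e\<close>, evaluated at \<open>M\<close>, gives this
    instance of Young's inequality. It trades the exponent \<open>q - 1\<close> in the energy of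
    \<rho> for the exponent q in \<open>F\<close>.\<close>
  have "q * M * x e powr (q - 1) \<le> M powr q + (q - 1) * x e powr q" if "e \<in> E" for e
  proof -
    have "x e * x e powr (q - 1) = x e powr q"
      using powr_mult_base[of "x e" "q - 1"] x_nonneg[OF that] by simp
    then show ?thesis
      using powr_above_tangent_weak[OF q, of M "x e"] x_nonneg[OF that] A \<open>A \<le> M\<close>
      by (simp add: algebra_simps)
  qed
  then have "(\<Sum>e\<in>E. q * M * x e powr (q - 1)) \<le> (\<Sum>e\<in>E. M powr q + (q - 1) * x e powr q)"
    by (rule sum_mono)
  also have "\<dots> = card E * M powr q + (q - 1) * F"
    by (simp add: sum.distrib F sum_distrib_left)
  \<comment> \<open>Bounding \<open>M powr q\<close> by \<open>F\<close> on every edge costs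
    \<open>card E * F\<close>, which becomes the error \<open>card E / q\<close> after division by
    \<open>q * F\<close>.\<close>
  also have "\<dots> \<le> card E * F + q * F"
    using \<open>M powr q \<le> F\<close> \<open>0 < F\<close> by (intro add_mono mult_left_mono mult_right_mono) auto
  finally have "q * (M * (\<Sum>e\<in>E. x e powr (q - 1))) \<le> (card E + q) * F"
    by (simp add: sum_distrib_left algebra_simps)
  moreover have "A * (\<Sum>e\<in>E. x e powr (q - 1)) \<le> M * (\<Sum>e\<in>E. x e powr (q - 1))"
    using \<open>A \<le> M\<close> by (intro mult_right_mono sum_nonneg) auto
  then have "q * (A * (\<Sum>e\<in>E. x e powr (q - 1))) \<le> q * (M * (\<Sum>e\<in>E. x e powr (q - 1)))"
    using q by simp
  ultimately have "q * (A * (\<Sum>e\<in>E. x e powr (q - 1))) \<le> (card E + q) * F"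
    by linarith
  then have "energy E 1 \<sigma> \<rho> * A \<le> 1 + card E / q"
    using q \<open>0 < F\<close> by (simp add: energy_\<rho> field_simps)
  then show ?thesis
    using \<rho> that by blast
qed

text \<open>Both optima exist by compactness, and weak duality bounds the product of their values
  below by 1. The densities of \<open>near_optimal_density_1\<close> bound it above by
  \<open>1 + card E / q\<close> for every \<open>q > 1\<close>, and the product does not depend on
  q.\<close>

lemma one_duality:
  assumes \<sigma>: "\<And>e. e \<in> E \<Longrightarrow> 0 < \<sigma> e"
  obtains \<rho> \<mu> where "optimal_density E N 1 \<sigma> \<Gamma> \<rho>" "optimal_mass E N \<infinity> (\<lambda>e. 1 / \<sigma> e) \<Gamma> \<mu>"
    "energy E 1 \<sigma> \<rho> * energy E \<infinity> (\<lambda>e. 1 / \<sigma> e) (usage \<mu>) = 1"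
proof -
  obtain \<rho> where \<rho>: "optimal_density E N 1 \<sigma> \<Gamma> \<rho>"
    using ex_optimal_density_1[where \<sigma> = \<sigma>] \<sigma> by blast
  obtain \<mu> where \<mu>: "optimal_mass E N \<infinity> (\<lambda>e. 1 / \<sigma> e) \<Gamma> \<mu>"
    using ex_optimal_mass_infinity by blast
  define A where "A = energy E \<infinity> (\<lambda>e. 1 / \<sigma> e) (usage \<mu>)"
  define V where "V = energy E 1 \<sigma> \<rho>"
  have mem: "\<rho> \<in> Adm E N \<Gamma>" "\<mu> \<in> mass_functions \<Gamma>"
    and V: "\<And>x. x \<in> Adm E N \<Gamma> \<Longrightarrow> V \<le> energy E 1 \<sigma> x"
    and A: "\<And>\<nu>. \<nu> \<in> mass_functions \<Gamma> \<Longrightarrow> A \<le> energy E \<infinity> (\<lambda>e. 1 / \<sigma> e) (usage \<nu>)"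
    using \<rho> \<mu> by (auto simp: optimal_density_def optimal_mass_def is_arg_min_linorder A_def V_def)
  have "1 \<le> V * A"
    unfolding V_def A_def by (rule weak_duality_1_infinity(2)[OF \<sigma> mem(2) mem(1)])
  have "0 < A"
  proof -
    obtain e where "e \<in> E" "0 < usage \<mu> e"
      using usage_pos[OF mem(2)] by blast
    then have "0 < 1 / \<sigma> e * usage \<mu> e"
      using \<sigma> by simp
    also have "\<dots> \<le> A"
      unfolding A_def using \<open>e \<in> E\<close> by (rule energy_infinity_ge)
    finally show ?thesis .
  qed
  have bound: "V * A \<le> 1 + card E / q" if q: "1 < q" for q
  proof -
    obtain x where x: "x \<in> Adm E N \<Gamma>" "energy E 1 \<sigma> x * A \<le> 1 + card E / q"
      using near_optimal_density_1[of \<sigma>, OF _ q \<open>0 < A\<close> A] \<sigma> by blast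
    then show ?thesis
      using mult_right_mono[OF V[OF x(1)], of A] x(2) \<open>0 < A\<close> by linarith
  qed
  have "((\<lambda>q. 1 + card E / q) \<longlongrightarrow> 1 + 0) at_top"
    by (intro tendsto_intros tendsto_divide_0[OF tendsto_const] filterlim_at_top_imp_at_infinity
      filterlim_ident)
  then have "V * A \<le> 1 + 0"
    using bound by (intro tendsto_lowerbound[where F = at_top])
      (auto intro: eventually_mono[OF eventually_gt_at_top[of 1]])
  then show ?thesis
    using \<open>1 \<le> V * A\<close> \<rho> \<mu> that by (auto simp: V_def A_def)
qed

end

section \<open>Time-respecting paths as a usage family\<close>

text \<open>A path is a set of pairs of an edge and one of its available times, and there are only
  finitely many such pairs.\<close>

lemma finite_time_respecting_paths:
  assumes "temporal_graph G \<sigma> T"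
  shows "finite (time_respecting_paths G directed vertex_simple T s t)"
proof -
  interpret temporal_graph G \<sigma> T by fact
  have "time_respecting_paths G directed vertex_simple T s t \<subseteq> Pow (Sigma (arcs G) T)"
    by (fastforce simp: time_respecting_paths_def set_zip)
  then show ?thesis
    by (rule finite_subset) (auto intro: finite_SigmaI finite_times)
qed

text \<open>Distinct end vertices exclude the empty path, so a first edge exists. Uniqueness of its
  time justifies the \<open>THE\<close> in \<open>temporal_usage\<close>, and positivity of the time
  yields positive usage.\<close>

lemma time_respecting_path_first_edge:
  assumes "temporal_graph G \<sigma> T" and "s \<noteq> t"
    and "\<gamma> \<in> time_respecting_paths G directed vertex_simple T s t"
  obtains e \<tau> where "e \<in> arcs G" "0 < \<tau>" "(e, \<tau>) \<in> \<gamma>" "\<forall>\<tau>'. (e, \<tau>') \<in> \<gamma> \<longrightarrow> \<tau>' = \<tau>"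
proof -
  interpret temporal_graph G \<sigma> T by fact
  obtain es ts vs where \<gamma>: "\<gamma> = set (zip es ts)" "length ts = length es" "length vs = length es + 1"
      "set es \<subseteq> arcs G" "distinct es" "hd vs = s" "last vs = t" "\<forall>i < length es. ts ! i \<in> T (es ! i)"
    using assms(3) by (auto simp: time_respecting_paths_def)
  \<comment> \<open>Without edges \<open>vs\<close> would have exactly one entry, forcing
    \<open>hd vs = last vs\<close>.\<close>
  have "es \<noteq> []"
    using \<gamma> \<open>s \<noteq> t\<close> by (auto simp: length_Suc_conv)
  then have "es ! 0 \<in> arcs G" "(es ! 0, ts ! 0) \<in> \<gamma>" "ts ! 0 \<in> T (es ! 0)"
    using \<gamma> by (auto simp: set_zip)
  \<comment> \<open>As \<open>es\<close> is distinct, the edge determines its index and hence its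
    time.\<close>
  moreover have "\<forall>\<tau>'. (es ! 0, \<tau>') \<in> \<gamma> \<longrightarrow> \<tau>' = ts ! 0"
    using \<gamma> \<open>es \<noteq> []\<close> by (auto simp: set_zip nth_eq_iff_index_eq)
  moreover have "0 < ts ! 0"
    using times_pos[OF \<open>es ! 0 \<in> arcs G\<close>] \<open>ts ! 0 \<in> T (es ! 0)\<close> by auto
  ultimately show ?thesis
    by (intro that)
qed

text \<open>The row of a path is positive at its first edge, since strict monotonicity gives
  \<open>\<phi> \<tau> > \<phi> 0 = 1\<close> at a positive time.\<close>

lemma usage_family_time_respecting_paths:
  assumes "temporal_graph G \<sigma> T" "temporal_penalty \<phi>" "s \<noteq> t"
    and "time_respecting_paths G directed vertex_simple T s t \<noteq> {}"
  shows "usage_family (arcs G) (time_respecting_paths G directed vertex_simple T s t)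
    (temporal_usage \<phi>)"
proof
  show "finite (arcs G)"
    using assms(1) by (simp add: temporal_graph_def fin_digraph.finite_arcs)
next
  fix \<gamma> e
  show "0 \<le> temporal_usage \<phi> \<gamma> e"
    using assms(2) by (simp add: temporal_usage_def temporal_penalty_def)
next
  fix \<gamma> assume \<gamma>: "\<gamma> \<in> time_respecting_paths G directed vertex_simple T s t"
  obtain e \<tau> where e: "e \<in> arcs G" "0 < \<tau>" "(e, \<tau>) \<in> \<gamma>"
      "\<forall>\<tau>'. (e, \<tau>') \<in> \<gamma> \<longrightarrow> \<tau>' = \<tau>"
    using time_respecting_path_first_edge[OF assms(1,3) \<gamma>] by blast
  then have "(THE \<tau>'. (e, \<tau>') \<in> \<gamma>) = \<tau>"
    by (intro the_equality) blast+
  then have "temporal_usage \<phi> \<gamma> e = \<phi> \<tau>"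
    unfolding temporal_usage_def using e(3) by (simp only: if_P exI)
  moreover have "\<phi> 0 < \<phi> \<tau>" "\<phi> 0 = 1"
    using strict_monoD[of \<phi> 0 \<tau>] assms(2) e(2) by (simp_all only: temporal_penalty_def)
  ultimately show "\<exists>e\<in>arcs G. 0 < temporal_usage \<phi> \<gamma> e"
    using e(1) by (intro bexI[of _ e]) simp_all
qed (rule finite_time_respecting_paths[OF assms(1)] assms(4))+

theorem theorem3p2:
  fixes G :: "('v, 'e) pre_digraph" and directed vertex_simple :: bool
    and \<sigma> :: "'e \<Rightarrow> real" and T :: "'e \<Rightarrow> real set" and \<phi> :: "real \<Rightarrow> real"
    and s t :: 'v and E :: "'e set" and \<Gamma> :: "('e \<times> real) set set"
    and N :: "('e \<times> real) set \<Rightarrow> 'e \<Rightarrow> real"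
  assumes "temporal_graph G \<sigma> T"
    and "temporal_penalty \<phi>"
    and "s \<in> verts G" and "t \<in> verts G" and "s \<noteq> t"
    and E: "E = arcs G"
    and \<Gamma>: "\<Gamma> = time_respecting_paths G directed vertex_simple T s t"
    and N: "N = temporal_usage \<phi>"
    and "\<Gamma> \<noteq> {}"
  shows
    "(\<forall>p q \<sigma>' :: 'e \<Rightarrow> real.
        1 < p \<longrightarrow> q = p / (p - 1) \<longrightarrow> \<sigma>' = (\<lambda>e. \<sigma> e powr (- q / p)) \<longrightarrow>
        Modulus E N (ereal p) \<sigma> \<Gamma> =
          minimum (\<lambda>\<mu>. \<Sum>e\<in>E. \<sigma>' e * expected_usage E N \<Gamma> \<mu> e powr q) (mass_functions \<Gamma>)
            powr (- p / q) \<and>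
        Modulus E N (ereal p) \<sigma> \<Gamma> =
          minimum (\<lambda>\<mu>. energy E (ereal q) \<sigma>' (expected_usage E N \<Gamma> \<mu>)) (mass_functions \<Gamma>)
            powr (- p / q) \<and>
        (\<exists>!\<rho>. optimal_density E N (ereal p) \<sigma> \<Gamma> \<rho>) \<and>
        (\<exists>\<mu>. optimal_mass E N (ereal q) \<sigma>' \<Gamma> \<mu>) \<and>
        (\<exists>!\<eta>. \<exists>\<mu>. optimal_mass E N (ereal q) \<sigma>' \<Gamma> \<mu> \<and> \<eta> = expected_usage E N \<Gamma> \<mu>) \<and>
        (\<forall>\<rho> \<mu> \<eta>. optimal_density E N (ereal p) \<sigma> \<Gamma> \<rho> \<longrightarrow>
           optimal_mass E N (ereal q) \<sigma>' \<Gamma> \<mu> \<longrightarrow> \<eta> = expected_usage E N \<Gamma> \<mu> \<longrightarrow>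
           (\<forall>e\<in>E. \<sigma> e * \<rho> e powr p / energy E (ereal p) \<sigma> \<rho> =
                  \<sigma>' e * \<eta> e powr q / energy E (ereal q) \<sigma>' \<eta>)))
     \<and>
     ((\<exists>\<rho>. optimal_density E N 1 \<sigma> \<Gamma> \<rho>) \<and>
      (\<exists>\<mu>. optimal_mass E N \<infinity> (\<lambda>e. 1 / \<sigma> e) \<Gamma> \<mu>) \<and>
      inverse (Modulus E N 1 \<sigma> \<Gamma>) =
        minimum (\<lambda>\<mu>. energy E \<infinity> (\<lambda>e. 1 / \<sigma> e) (expected_usage E N \<Gamma> \<mu>)) (mass_functions \<Gamma>))
     \<and>
     ((\<exists>\<rho>. optimal_density E N \<infinity> \<sigma> \<Gamma> \<rho>) \<and>
      (\<exists>\<mu>. optimal_mass E N 1 (\<lambda>e. 1 / \<sigma> e) \<Gamma> \<mu>) \<and>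
      inverse (Modulus E N \<infinity> \<sigma> \<Gamma>) =
        minimum (\<lambda>\<mu>. energy E 1 (\<lambda>e. 1 / \<sigma> e) (expected_usage E N \<Gamma> \<mu>)) (mass_functions \<Gamma>))"
proof -
  interpret usage_family E \<Gamma> N
    unfolding E \<Gamma> N using assms by (intro usage_family_time_respecting_paths) auto
  have \<sigma>: "\<forall>e\<in>E. 0 < \<sigma> e"
    using assms(1) by (simp add: E temporal_graph.weight_pos)
  have energy_q: "energy E (ereal q) w x = (\<Sum>e\<in>E. w e * x e powr q)" for q w x
    by (simp add: energy_def)
  obtain \<rho> \<mu> where one: "optimal_density E N 1 \<sigma> \<Gamma> \<rho>"
    "optimal_mass E N \<infinity> (\<lambda>e. 1 / \<sigma> e) \<Gamma> \<mu>"
    "energy E 1 \<sigma> \<rho> * energy E \<infinity> (\<lambda>e. 1 / \<sigma> e) (usage \<mu>) = 1"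
    using one_duality[of \<sigma>] \<sigma> by blast
  obtain \<rho>' \<mu>' where inf: "optimal_density E N \<infinity> \<sigma> \<Gamma> \<rho>'"
    "optimal_mass E N 1 (\<lambda>e. 1 / \<sigma> e) \<Gamma> \<mu>'"
    "energy E \<infinity> \<sigma> \<rho>' * energy E 1 (\<lambda>e. 1 / \<sigma> e) (usage \<mu>') = 1"
    using infinity_duality[of \<sigma>] \<sigma> by blast
  show ?thesis
  proof (intro conjI allI impI)
    fix p q :: real and \<sigma>' :: "'e \<Rightarrow> real"
    assume pq: "1 < p" "q = p / (p - 1)" "\<sigma>' = (\<lambda>e. \<sigma> e powr (- q / p))"
    note dual = p_duality[OF pq(1,2) \<sigma> pq(3)]
    show "Modulus E N (ereal p) \<sigma> \<Gamma> =
          minimum (\<lambda>\<mu>. \<Sum>e\<in>E. \<sigma>' e * usage \<mu> e powr q) (mass_functions \<Gamma>) powr (- p / q)"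
      using dual(1) by (simp only: energy_q)
    show "Modulus E N (ereal p) \<sigma> \<Gamma> =
          minimum (\<lambda>\<mu>. energy E (ereal q) \<sigma>' (usage \<mu>)) (mass_functions \<Gamma>) powr (- p / q)"
      by (rule dual(1))
    show "\<exists>!\<rho>. optimal_density E N (ereal p) \<sigma> \<Gamma> \<rho>"
      by (rule dual(2))
    show "\<exists>\<mu>. optimal_mass E N (ereal q) \<sigma>' \<Gamma> \<mu>"
      by (rule dual(3))
    show "\<exists>!\<eta>. \<exists>\<mu>. optimal_mass E N (ereal q) \<sigma>' \<Gamma> \<mu> \<and> \<eta> = usage \<mu>"
      by (rule dual(4))
    show "\<forall>e\<in>E. \<sigma> e * \<rho> e powr p / energy E (ereal p) \<sigma> \<rho> =
                  \<sigma>' e * \<eta> e powr q / energy E (ereal q) \<sigma>' \<eta>"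
      if "optimal_density E N (ereal p) \<sigma> \<Gamma> \<rho>" "optimal_mass E N (ereal q) \<sigma>' \<Gamma> \<mu>"
        "\<eta> = usage \<mu>" for \<rho> \<mu> \<eta>
      using dual(5)[OF that(1,2)] that(3) by simp
  next
    \<comment> \<open>The two minima are the values at the optimal pair, whose product is 1, so one
      is the inverse of the other. The case of exponent infinity is identical.\<close>
    show "inverse (Modulus E N 1 \<sigma> \<Gamma>) =
        minimum (\<lambda>\<mu>. energy E \<infinity> (\<lambda>e. 1 / \<sigma> e) (usage \<mu>)) (mass_functions \<Gamma>)"
      using minimum_eqI[OF one(1)[unfolded optimal_density_def]]
        minimum_eqI[OF one(2)[unfolded optimal_mass_def]] inverse_unique[OF one(3)]
      by (simp add: Modulus_def)
    show "inverse (Modulus E N \<infinity> \<sigma> \<Gamma>) =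
        minimum (\<lambda>\<mu>. energy E 1 (\<lambda>e. 1 / \<sigma> e) (usage \<mu>)) (mass_functions \<Gamma>)"
      using minimum_eqI[OF inf(1)[unfolded optimal_density_def]]
        minimum_eqI[OF inf(2)[unfolded optimal_mass_def]] inverse_unique[OF inf(3)]
      by (simp add: Modulus_def)
  qed (rule exI, rule one inf)+
qed

end
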